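(* Let $n\ge 2$ and let $\mathcal{T}_n$ be the set of all $n$-tournaments up to isomorphism. If $n$ is odd, then every regular $n$-tournament minimizes $f_2$ and minimizes $f_3$ over $\mathcal{T}_n$. If $n$ is even, then every nearly-regular $n$-tournament minimizes $f_2$ and minimizes $f_3$ over $\mathcal{T}_n$.
   Context: An $n$-tournament $T$ is a directed graph on $n$ vertices such that for each pair of distinct vertices $x,y$ exactly one of the arcs $x\to y$, $y\to x$ is present (no loops). The score (out-degree) $d^+(v)$ of a vertex $v$ is the number of arcs with tail $v$. The Laplacian of $T$ is $L_T=D-A$, where $A$ is the adjacency matrix ($A(i,j)=1$ if $v_i\to v_j$, else $0$) and $D$ is the diagonal matrix of out-degrees. The normalized Laplacian is $\overline{L}_T=\frac{1}{\mathrm{tr}(L_T)}L_T=\binom{n}{2}^{-1}(D-A)$, and $\Lambda_T$ is its spectrum (the multiset of its complex eigenvalues with algebraic multiplicity). For a positive integer $k$, $f_k(T)=\sum_{\lambda\in\Lambda_T}\lambda^k$ (a real number, equal to $\mathrm{tr}(\overline{L}_T^{\,k})$). For $n$ odd, $T$ is regular if every vertex has score $\frac{n-1}{2}$. For $n$ even, $T$ is nearly-regular if $\frac n2$ of its vertices have score $\frac n2-1$ and the other $\frac n2$ vertices have score $\frac n2$. *)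

theory Defs
  imports
    Complex_Main
    "Jordan_Normal_Form.Char_Poly"
    "Graph_Theory.Pair_Digraph"
    "Graph_Theory.Digraph_Isomorphism"
begin

text \<open>
  Tournaments are loop-free digraphs without parallel arcs, with labelled vertex set
  \<open>{..<n}\<close>, so that adjacency matrices can be indexed by the vertices. Every tournament
  on \<open>n\<close> vertices is isomorphic to one of these, and the quantities studied below do not
  depend on the labelling (lemma \<open>power_sum_iso\<close>).
\<close>

definition tournaments :: "nat \<Rightarrow> nat pair_pre_digraph set" where
  "tournaments n = {T. pair_digraph T \<and> pverts T = {..<n} \<and>
     (\<forall>x\<in>pverts T. \<forall>y\<in>pverts T. x \<noteq> y \<longrightarrow> ((x, y) \<in> parcs T) \<noteq> ((y, x) \<in> parcs T))}"

definition score :: "nat pair_pre_digraph \<Rightarrow> nat \<Rightarrow> nat" where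
  "score T v = out_degree (with_proj T) v"

definition adjacency_mat :: "nat pair_pre_digraph \<Rightarrow> complex mat" where
  "adjacency_mat T = mat (card (pverts T)) (card (pverts T))
     (\<lambda>(i, j). if (i, j) \<in> parcs T then 1 else 0)"

definition degree_mat :: "nat pair_pre_digraph \<Rightarrow> complex mat" where
  "degree_mat T = mat_diag (card (pverts T)) (\<lambda>i. of_nat (score T i))"

definition laplacian :: "nat pair_pre_digraph \<Rightarrow> complex mat" where
  "laplacian T = degree_mat T - adjacency_mat T"

definition mat_trace :: "complex mat \<Rightarrow> complex" where
  "mat_trace M = sum_list (diag_mat M)"

definition normalized_laplacian :: "nat pair_pre_digraph \<Rightarrow> complex mat" where
  "normalized_laplacian T = (1 / mat_trace (laplacian T)) \<cdot>\<^sub>m laplacian T"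

text \<open>Eigenvalues counted with algebraic multiplicity.\<close>

definition eigenvalues_mset :: "nat pair_pre_digraph \<Rightarrow> complex multiset" where
  "eigenvalues_mset T = proots (char_poly (normalized_laplacian T))"

text \<open>
  The power sum of the eigenvalues is a real number (lemma \<open>of_real_power_sum\<close>), so taking
  the real part only changes its type.
\<close>

definition power_sum :: "nat \<Rightarrow> nat pair_pre_digraph \<Rightarrow> real" where
  "power_sum k T = Re (\<Sum>x\<in>#eigenvalues_mset T. x ^ k)"

definition regular_tournament :: "nat \<Rightarrow> nat pair_pre_digraph \<Rightarrow> bool" where
  "regular_tournament n T \<longleftrightarrow>
     T \<in> tournaments n \<and> odd n \<and> (\<forall>v\<in>pverts T. score T v = (n - 1) div 2)"

definition nearly_regular_tournament :: "nat \<Rightarrow> nat pair_pre_digraph \<Rightarrow> bool" where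
  "nearly_regular_tournament n T \<longleftrightarrow>
     T \<in> tournaments n \<and> even n \<and>
     card {v \<in> pverts T. score T v = n div 2 - 1} = n div 2 \<and>
     card {v \<in> pverts T. score T v = n div 2} = n div 2"

definition minimizes :: "(nat pair_pre_digraph \<Rightarrow> real) \<Rightarrow> nat \<Rightarrow> nat pair_pre_digraph \<Rightarrow> bool" where
  "minimizes f n T \<longleftrightarrow> is_arg_min f (\<lambda>S. S \<in> tournaments n) T"


lemma laplacian_carrier:
  "laplacian T \<in> carrier_mat (card (pverts T)) (card (pverts T))"
  by (auto simp: laplacian_def degree_mat_def adjacency_mat_def mat_diag_def)

lemma normalized_laplacian_carrier:
  "normalized_laplacian T \<in> carrier_mat (card (pverts T)) (card (pverts T))"
  using laplacian_carrier by (auto simp: normalized_laplacian_def)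

lemma laplacian_index:
  assumes "i < card (pverts T)" "j < card (pverts T)"
  shows "laplacian T $$ (i, j) =
    (if i = j then of_nat (score T i) else 0) - (if (i, j) \<in> parcs T then 1 else 0)"
  using assms by (auto simp: laplacian_def degree_mat_def adjacency_mat_def mat_diag_def)

lemma mat_trace_laplacian:
  "mat_trace (laplacian T) = (\<Sum>i<card (pverts T). laplacian T $$ (i, i))"
  using laplacian_carrier[of T]
  by (simp add: mat_trace_def diag_mat_def sum_list_sum_nth atLeast0LessThan)

text \<open>The trace of the Laplacian is the number of arcs.\<close>

lemma mat_trace_laplacian_tournament:
  assumes "T \<in> tournaments n"
  shows "mat_trace (laplacian T) = of_nat (n choose 2)"
proof -
  let ?A = "parcs T"
  from assms have pd: "pair_digraph T" and V: "pverts T = {..<n}"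
    and tour: "\<And>x y. x < n \<Longrightarrow> y < n \<Longrightarrow> x \<noteq> y \<Longrightarrow> ((x, y) \<in> ?A) \<noteq> ((y, x) \<in> ?A)"
    unfolding tournaments_def by blast+
  interpret pair_digraph T by (fact pd)
  have sub: "?A \<subseteq> {..<n} \<times> {..<n}"
    using V in_arcsD1 in_arcsD2 by auto
  have fin: "finite ?A" by (rule pair_finite_arcs)
  have "mat_trace (laplacian T) = (\<Sum>i<n. of_nat (score T i))"
    unfolding mat_trace_laplacian using V by (intro sum.cong) (auto simp: laplacian_index dest: no_loops')
  also have "\<dots> = of_nat (\<Sum>i<n. score T i)" by simp
  also have "(\<Sum>i<n. score T i) = (\<Sum>i<n. card {e \<in> ?A. fst e = i})"
    by (simp add: score_def out_degree_def out_arcs_def)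
  also have "\<dots> = card (\<Union>i<n. {e \<in> ?A. fst e = i})"
    using fin by (intro card_UN_disjoint[symmetric]) auto
  also have "(\<Union>i<n. {e \<in> ?A. fst e = i}) = ?A" using sub by auto
  also have "card ?A = card {B. B \<subseteq> {..<n} \<and> card B = 2}"
  proof (rule bij_betw_same_card[of "\<lambda>(x, y). {x, y}"], unfold bij_betw_def, intro conjI)
    show "inj_on (\<lambda>(x, y). {x, y}) ?A"
    proof (rule inj_onI, clarify)
      fix a b c d assume *: "(a, b) \<in> ?A" "(c, d) \<in> ?A" "{a, b} = {c, d}"
      have "a \<noteq> b" using *(1) by (rule no_loops')
      moreover have "a < n" "b < n" using sub *(1) by auto
      ultimately have "(b, a) \<notin> ?A" using tour[of a b] *(1) by blast
      then have "\<not> (a = d \<and> b = c)" using *(2) by blast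
      then show "a = c \<and> b = d" using *(3) unfolding doubleton_eq_iff by blast
    qed
    show "(\<lambda>(x, y). {x, y}) ` ?A = {B. B \<subseteq> {..<n} \<and> card B = 2}"
    proof (rule Set.set_eqI, rule iffI)
      fix B assume "B \<in> (\<lambda>(x, y). {x, y}) ` ?A"
      then obtain a b where "(a, b) \<in> ?A" "B = {a, b}" by auto
      moreover from this have "a \<noteq> b" "a < n" "b < n" using sub no_loops'[of a b] by auto
      ultimately show "B \<in> {B. B \<subseteq> {..<n} \<and> card B = 2}" by simp
    next
      fix B assume "B \<in> {B. B \<subseteq> {..<n} \<and> card B = 2}"
      then obtain a b where ab: "B = {a, b}" "a \<noteq> b" "a < n" "b < n"
        by (auto simp: card_2_iff)
      then have "(a, b) \<in> ?A \<or> (b, a) \<in> ?A" using tour by blast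
      moreover have "{b, a} = B" using ab(1) by blast
      ultimately show "B \<in> (\<lambda>(x, y). {x, y}) ` ?A" using ab(1) by (auto intro: rev_image_eqI)
    qed
  qed
  also have "\<dots> = n choose 2" using n_subsets[of "{..<n}" 2] by simp
  finally show ?thesis .
qed

lemma of_real_power_sum:
  "of_real (power_sum k T) = (\<Sum>x\<in>#eigenvalues_mset T. x ^ k)"
proof -
  interpret cnj_hom: comm_ring_hom cnj by unfold_locales auto
  let ?L = "laplacian T" and ?M = "normalized_laplacian T"
  let ?n = "card (pverts T)"
  define p where "p = char_poly ?M"
  have p0: "p \<noteq> 0"
    using degree_monic_char_poly[OF normalized_laplacian_carrier[of T]] by (auto simp: p_def)
  have cnjL: "cnj (?L $$ (i, j)) = ?L $$ (i, j)" if "i < ?n" "j < ?n" for i j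
    using that by (simp add: laplacian_index)
  have "cnj (mat_trace ?L) = mat_trace ?L"
    by (simp add: mat_trace_laplacian cnjL)
  then have "map_mat cnj ?M = ?M"
    using laplacian_carrier[of T] by (intro eq_matI) (auto simp: normalized_laplacian_def cnjL)
  then have p_cnj: "map_poly cnj p = p"
    using cnj_hom.char_poly_hom[OF normalized_laplacian_carrier[of T]] by (simp add: p_def)
  have cnj_dvd: "[:- cnj a, 1:] ^ m dvd map_poly cnj q" if "[:- a, 1:] ^ m dvd q"
    for a :: complex and m q
  proof -
    interpret map_poly_comm_ring_hom cnj by unfold_locales
    have "map_poly cnj ([:- a, 1:] ^ m) = [:- cnj a, 1:] ^ m"
      by (simp add: hom_power)
    with hom_dvd[OF that] show ?thesis by simp
  qed
  have le: "order a p \<le> order (cnj a) p" for a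
    using cnj_dvd[OF order_1[of a p]] p0 unfolding p_cnj by (simp add: order_divides)
  have order_cnj: "order (cnj a) p = order a p" for a
    using le[of a] le[of "cnj a"] by simp
  have "image_mset cnj (proots p) = proots p"
  proof (rule multiset_eqI)
    fix a
    have "{x. x \<in># proots p \<and> a = cnj x} = (if cnj a \<in># proots p then {cnj a} else {})"
      by auto
    then have "count (image_mset cnj (proots p)) a = count (proots p) (cnj a)"
      by (auto simp: count_image_mset' not_in_iff)
    then show "count (image_mset cnj (proots p)) a = count (proots p) a"
      using p0 by (simp add: order_cnj)
  qed
  then have im: "image_mset cnj (eigenvalues_mset T) = eigenvalues_mset T"
    by (simp add: eigenvalues_mset_def p_def)
  have "cnj (\<Sum>x\<in>#B. x ^ k) = (\<Sum>x\<in>#image_mset cnj B. x ^ k)" for B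
    by (induction B) auto
  from this[of "eigenvalues_mset T"]
  have "cnj (\<Sum>x\<in>#eigenvalues_mset T. x ^ k) = (\<Sum>x\<in>#eigenvalues_mset T. x ^ k)"
    unfolding im .
  then have "(\<Sum>x\<in>#eigenvalues_mset T. x ^ k) \<in> \<real>"
    by (simp only: Reals_cnj_iff)
  then show ?thesis by (simp add: power_sum_def)
qed

lemma power_sum_iso:
  assumes S: "S \<in> tournaments n" and T: "T \<in> tournaments n"
    and iso: "digraph_iso (with_proj S) (with_proj T)"
  shows "power_sum k S = power_sum k T"
proof -
  from S T have pdS: "pair_digraph S" and VS: "pverts S = {..<n}"
    and pdT: "pair_digraph T" and VT: "pverts T = {..<n}" by (auto simp: tournaments_def)
  interpret S: pair_digraph S by (fact pdS)
  interpret T: pair_digraph T by (fact pdT)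
  from iso obtain f where f: "pre_digraph.digraph_isomorphism (with_proj S) f"
    and Tf: "with_proj T = app_iso f (with_proj S)"
    by (auto simp: digraph_iso_def)
  define h where "h = iso_verts f"
  have inj: "inj_on h {..<n}"
    using f VS by (simp add: pre_digraph.digraph_isomorphism_def h_def)
  have "verts (with_proj T) = h ` verts (with_proj S)"
    unfolding Tf h_def by simp
  then have bij: "bij_betw h {..<n} {..<n}"
    using inj VS VT by (simp add: bij_betw_def)
  have "arcs_ends (with_proj T) = map_prod h h ` arcs_ends (with_proj S)"
    using f unfolding Tf
    by (force simp: arcs_ends_conv pre_digraph.digraph_isomorphism_def h_def image_image)
  then have arcs: "parcs T = map_prod h h ` parcs S" by simp
  have lt: "h i < n" if "i < n" for i using bij that by (auto simp: bij_betw_def)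
  have h_eq: "h i = h j \<longleftrightarrow> i = j" if "i < n" "j < n" for i j
    using inj that by (auto dest: inj_onD)
  have S_lt: "i < n" "j < n" if "(i, j) \<in> parcs S" for i j
    using S.in_arcsD1[OF that] S.in_arcsD2[OF that] VS by auto
  have arc_iff: "(h i, h j) \<in> parcs T \<longleftrightarrow> (i, j) \<in> parcs S" if "i < n" "j < n" for i j
  proof
    assume "(h i, h j) \<in> parcs T"
    then obtain a b where "(a, b) \<in> parcs S" "h i = h a" "h j = h b"
      unfolding arcs by auto
    with that show "(i, j) \<in> parcs S" by (auto simp: h_eq S_lt)
  next
    assume "(i, j) \<in> parcs S"
    then show "(h i, h j) \<in> parcs T" unfolding arcs by (rule rev_image_eqI) simp
  qed
  have score_iff: "score T (h i) = score S i" if "i < n" for i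
  proof -
    have "{e \<in> parcs T. fst e = h i} = map_prod h h ` {e \<in> parcs S. fst e = i}"
      using that unfolding arcs by (auto simp: h_eq S_lt)
    moreover have "inj_on (map_prod h h) {e \<in> parcs S. fst e = i}"
      by (auto simp: inj_on_def h_eq S_lt)
    ultimately show ?thesis
      by (simp add: score_def out_degree_def out_arcs_def card_image)
  qed
  have L: "laplacian S $$ (i, j) = laplacian T $$ (h i, h j)" if "i < n" "j < n" for i j
    using that VS VT lt by (simp add: laplacian_index arc_iff score_iff h_eq)
  have tr: "mat_trace (laplacian S) = mat_trace (laplacian T)"
    by (simp only: mat_trace_laplacian_tournament[OF S] mat_trace_laplacian_tournament[OF T])
  let ?A = "normalized_laplacian S" and ?B = "normalized_laplacian T"
  have cA: "?A \<in> carrier_mat n n" and cB: "?B \<in> carrier_mat n n"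
    using normalized_laplacian_carrier[of S] normalized_laplacian_carrier[of T] VS VT by auto
  have AB: "?A $$ (i, j) = ?B $$ (h i, h j)" if "i < n" "j < n" for i j
    using that lt laplacian_carrier[of S] laplacian_carrier[of T] VS VT
    by (simp add: normalized_laplacian_def tr L)
  define P :: "complex mat" where "P = mat n n (\<lambda>(i, j). if j = h i then 1 else 0)"
  define Q :: "complex mat" where "Q = mat n n (\<lambda>(i, j). if i = h j then 1 else 0)"
  have cP: "P \<in> carrier_mat n n" and cQ: "Q \<in> carrier_mat n n" by (auto simp: P_def Q_def)
  have PX: "(P * X) $$ (i, j) = X $$ (h i, j)" if "i < n" "j < n" "X \<in> carrier_mat n n" for X i j
  proof -
    have "(P * X) $$ (i, j) = (\<Sum>l<n. (if l = h i then 1 else 0) * X $$ (l, j))"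
      using that by (simp add: P_def scalar_prod_def atLeast0LessThan)
    also have "\<dots> = (\<Sum>l<n. if l = h i then X $$ (l, j) else 0)"
      by (intro sum.cong) auto
    also have "\<dots> = X $$ (h i, j)" using lt[OF that(1)] by simp
    finally show ?thesis .
  qed
  have XQ: "(X * Q) $$ (i, j) = X $$ (i, h j)" if "i < n" "j < n" "X \<in> carrier_mat n n" for X i j
  proof -
    have "(X * Q) $$ (i, j) = (\<Sum>l<n. X $$ (i, l) * (if l = h j then 1 else 0))"
      using that by (simp add: Q_def scalar_prod_def atLeast0LessThan)
    also have "\<dots> = (\<Sum>l<n. if l = h j then X $$ (i, l) else 0)"
      by (intro sum.cong) auto
    also have "\<dots> = X $$ (i, h j)" using lt[OF that(2)] by simp
    finally show ?thesis .
  qed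
  have PQ: "P * Q = 1\<^sub>m n"
  proof (rule eq_matI)
    fix i j assume "i < dim_row (1\<^sub>m n)" "j < dim_col (1\<^sub>m n)"
    then have "i < n" "j < n" by auto
    with XQ[OF this cP] lt show "(P * Q) $$ (i, j) = 1\<^sub>m n $$ (i, j)"
      by (auto simp: P_def h_eq)
  qed (auto simp: P_def Q_def)
  have "similar_mat ?A ?B"
    unfolding similar_mat_def
  proof (intro exI similar_mat_witI)
    show "P * Q = 1\<^sub>m n" by (fact PQ)
    show "Q * P = 1\<^sub>m n" by (rule mat_mult_left_right_inverse[OF cP cQ PQ])
    show "?A = P * ?B * Q"
    proof (rule eq_matI)
      fix i j assume "i < dim_row (P * ?B * Q)" "j < dim_col (P * ?B * Q)"
      then have ij: "i < n" "j < n" by (auto simp: P_def Q_def)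
      have "P * ?B \<in> carrier_mat n n" using cP cB by auto
      with ij show "?A $$ (i, j) = (P * ?B * Q) $$ (i, j)"
        using XQ[OF ij, of "P * ?B"] PX[OF ij(1) lt[OF ij(2)] cB] AB[OF ij] by simp
    qed (use cA cP cQ in auto)
  qed (use cA cB cP cQ in auto)
  then have "char_poly ?A = char_poly ?B" by (rule char_poly_similar)
  then show ?thesis by (simp add: power_sum_def eigenvalues_mset_def)
qed

end

theory Submission
  imports Defs "Jordan_Normal_Form.Schur_Decomposition"
begin

text \<open>
  The power sums of the eigenvalues are traces of powers of the Laplacian. The scores \<open>d\<^sub>i\<close> satisfy
  \<open>tr L\<^sup>2 = \<Sum> d\<^sub>i\<^sup>2\<close>, and since the number of cyclic triangles of a tournament is determined by its
  scores, \<open>2 tr L\<^sup>3 = \<Sum> (2 d\<^sub>i\<^sup>3 + 3 d\<^sub>i\<^sup>2) - (2 n - 1) \<Sum> d\<^sub>i\<close>. As \<open>\<Sum> d\<^sub>i\<close> depends on \<open>n\<close> only, both are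
  sums of convex functions of integers with prescribed sum, and are smallest when all \<open>d\<^sub>i\<close> lie
  in \<open>{a, a + 1}\<close> for some \<open>a\<close>: compare with the chord of the convex function through these points.
\<close>

section \<open>Power sums of eigenvalues as traces\<close>

lemma mat_trace_eq_sum:
  assumes "A \<in> carrier_mat n n"
  shows "mat_trace A = (\<Sum>i<n. A $$ (i, i))"
  using assms by (simp add: mat_trace_def diag_mat_def sum_list_sum_nth atLeast0LessThan)

lemma index_mult_mat_sum:
  assumes "A \<in> carrier_mat n m" "B \<in> carrier_mat m p" "i < n" "j < p"
  shows "(A * B) $$ (i, j) = (\<Sum>k<m. A $$ (i, k) * B $$ (k, j))"
  using assms by (simp add: scalar_prod_def atLeast0LessThan)

lemma mat_trace_mult_comm:
  assumes A: "A \<in> carrier_mat n m" and B: "B \<in> carrier_mat m n"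
  shows "mat_trace (A * B) = mat_trace (B * A)"
proof -
  have AB: "A * B \<in> carrier_mat n n" and BA: "B * A \<in> carrier_mat m m" using A B by auto
  have "mat_trace (A * B) = (\<Sum>i<n. \<Sum>k<m. A $$ (i, k) * B $$ (k, i))"
    using A B by (simp add: mat_trace_eq_sum[OF AB] index_mult_mat_sum[OF A B] del: index_mult_mat)
  also have "\<dots> = (\<Sum>k<m. \<Sum>i<n. B $$ (k, i) * A $$ (i, k))"
    by (subst sum.swap) (simp add: mult.commute)
  also have "\<dots> = mat_trace (B * A)"
    using A B by (simp add: mat_trace_eq_sum[OF BA] index_mult_mat_sum[OF B A] del: index_mult_mat)
  finally show ?thesis .
qed

text \<open>Cyclicity of the trace moves \<open>P\<close> behind \<open>Q\<close>, where the two
  cancel.\<close>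

lemma mat_trace_similar:
  assumes "similar_mat_wit A B P Q"
  shows "mat_trace A = mat_trace B"
proof -
  obtain n where n: "n = dim_row A" by blast
  have A: "A = P * B * Q" and QP: "Q * P = 1\<^sub>m n" and B: "B \<in> carrier_mat n n"
    and P: "P \<in> carrier_mat n n" and Q: "Q \<in> carrier_mat n n"
    using similar_mat_witD[OF n assms] by blast+
  have "mat_trace A = mat_trace (P * (B * Q))"
    unfolding A assoc_mult_mat[OF P B Q] ..
  also have "\<dots> = mat_trace (B * Q * P)"
    by (rule mat_trace_mult_comm[OF P mult_carrier_mat[OF B Q]])
  also have "B * Q * P = B"
    unfolding assoc_mult_mat[OF B Q P] QP using B by simp
  finally show ?thesis .
qed

lemma upper_triangular_mult:
  assumes A: "A \<in> carrier_mat n n" "upper_triangular A"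
    and B: "B \<in> carrier_mat n n" "upper_triangular B"
  shows "upper_triangular (A * B)"
    and "i < n \<Longrightarrow> (A * B) $$ (i, i) = A $$ (i, i) * B $$ (i, i)"
proof -
  show "upper_triangular (A * B)"
  proof (rule upper_triangularI)
    fix i j assume ji: "j < i" and "i < dim_row (A * B)"
    then have i: "i < n" using A by simp
    \<comment> \<open>Below the diagonal every summand has a zero factor: the first one if
      \<open>k < i\<close>, the second one if \<open>k \<ge> i\<close>, since then
      \<open>k > j\<close>.\<close>
    have "A $$ (i, k) * B $$ (k, j) = 0" if "k < n" for k
      using upper_triangularD[OF A(2), of k i] upper_triangularD[OF B(2), of j k] A B i ji that
      by (cases "k < i") auto
    then show "(A * B) $$ (i, j) = 0"
      using i ji by (simp add: index_mult_mat_sum[OF A(1) B(1)] del: index_mult_mat)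
  qed
  assume i: "i < n"
  have "A $$ (i, k) * B $$ (k, i) = (if k = i then A $$ (i, i) * B $$ (i, i) else 0)"
    if "k < n" for k
    using upper_triangularD[OF A(2), of k i] upper_triangularD[OF B(2), of i k] A B i that
    by (cases k i rule: linorder_cases) auto
  then have "(\<Sum>k<n. A $$ (i, k) * B $$ (k, i)) =
      (\<Sum>k<n. if k = i then A $$ (i, i) * B $$ (i, i) else 0)"
    by (intro sum.cong) auto
  then show "(A * B) $$ (i, i) = A $$ (i, i) * B $$ (i, i)"
    using i by (simp only: index_mult_mat_sum[OF A(1) B(1) i i]) simp
qed

lemma upper_triangular_pow:
  assumes A: "A \<in> carrier_mat n n" "upper_triangular A"
  shows "upper_triangular (A ^\<^sub>m k) \<and> (\<forall>i<n. (A ^\<^sub>m k) $$ (i, i) = (A $$ (i, i)) ^ k)"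
proof (induction k)
  case 0
  show ?case using A by auto
next
  case (Suc k)
  then show ?case
    using upper_triangular_mult[OF pow_carrier_mat[OF A(1)] _ A, of k] by (simp add: power_commutes)
qed

text \<open>Schur decomposition makes \<open>A\<close> similar to an upper triangular
  \<open>B\<close> whose diagonal lists the eigenvalues. The diagonal of a power of \<open>B\<close>
  consists of the powers of these entries, and the trace is invariant under similarity.\<close>

lemma sum_proots_char_poly_power:
  fixes A :: "complex mat"
  assumes A: "A \<in> carrier_mat n n"
  shows "(\<Sum>x\<in>#proots (char_poly A). x ^ k) = mat_trace (A ^\<^sub>m k)"
proof -
  obtain es where es: "char_poly A = (\<Prod>e\<leftarrow>es. [:- e, 1:])"
    using char_poly_factorized[OF A] by blast
  obtain B P Q where "schur_decomposition A es = (B, P, Q)"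
    by (cases "schur_decomposition A es") auto
  with schur_decomposition[OF A es] have sim: "similar_mat_wit A B P Q"
    and ut: "upper_triangular B" and diag: "diag_mat B = es" by blast+
  have B: "B \<in> carrier_mat n n" using similar_mat_witD2[OF A sim] by blast
  \<comment> \<open>Hence \<open>es\<close> lists the eigenvalues with their algebraic
    multiplicities.\<close>
  have "proots (\<Prod>e\<leftarrow>xs. [:- e, 1:]) = mset xs" for xs :: "complex list"
  proof (induction xs)
    case (Cons x xs)
    have "(\<Prod>e\<leftarrow>xs. [:- e, 1:]) \<noteq> 0" by auto
    from proots_mult[OF _ this, of "[:- x, 1:]"] Cons show ?case
      by (simp del: mult_pCons_left)
  qed simp
  then have "proots (char_poly A) = mset es" unfolding es .
  then have "(\<Sum>x\<in>#proots (char_poly A). x ^ k) = (\<Sum>x\<leftarrow>diag_mat B. x ^ k)"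
    by (metis diag mset_map sum_mset_sum_list)
  also have "\<dots> = (\<Sum>i<n. (B $$ (i, i)) ^ k)"
    using B by (simp add: diag_mat_def sum_list_sum_nth atLeast0LessThan)
  also have "\<dots> = mat_trace (B ^\<^sub>m k)"
    using upper_triangular_pow[OF B ut, of k]
    by (simp add: mat_trace_eq_sum[OF pow_carrier_mat[OF B]])
  also have "\<dots> = mat_trace (A ^\<^sub>m k)"
    using mat_trace_similar[OF similar_mat_wit_pow[OF sim]] by simp
  finally show ?thesis .
qed

lemma mat_trace_pow2:
  assumes A: "A \<in> carrier_mat n n"
  shows "mat_trace (A ^\<^sub>m 2) = (\<Sum>i<n. \<Sum>j<n. A $$ (i, j) * A $$ (j, i))"
  using A by (simp add: numeral_2_eq_2 mat_trace_eq_sum[OF mult_carrier_mat[OF A A]]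
      index_mult_mat_sum[OF A A] del: index_mult_mat)

lemma mat_trace_pow3:
  assumes A: "A \<in> carrier_mat n n"
  shows "mat_trace (A ^\<^sub>m 3) =
    (\<Sum>i<n. \<Sum>j<n. \<Sum>k<n. A $$ (i, j) * A $$ (j, k) * A $$ (k, i))"
proof -
  have AA: "A * A \<in> carrier_mat n n" using A by simp
  have "A ^\<^sub>m 3 = A * (A * A)" using A by (simp add: numeral_3_eq_3)
  then show ?thesis
    using A by (simp add: mat_trace_eq_sum[OF mult_carrier_mat[OF A AA]]
        index_mult_mat_sum[OF A AA] index_mult_mat_sum[OF A A] sum_distrib_left mult.assoc
        del: index_mult_mat)
qed

section \<open>Traces in terms of scores\<close>

text \<open>Double counting, with \<open>a\<close> as the 0-1 adjacency matrix and \<open>d\<close>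
  as the out-degrees. Let \<open>c\<close> count closed walks of length 3 (three for each cyclic
  triangle) and \<open>t\<close> transitive triples. Counting directed 2-paths gives
  \<open>c + t\<close>, counting pairs of out-neighbours of a vertex gives \<open>2 * t\<close>, and
  eliminating \<open>t\<close> leaves \<open>c\<close>.\<close>

lemma sum_cyclic_triples:
  fixes a :: "nat \<Rightarrow> nat \<Rightarrow> 'a :: comm_ring_1"
  assumes idem: "\<And>i j. a i j * a i j = a i j"
    and tour: "\<And>i j. i < n \<Longrightarrow> j < n \<Longrightarrow> a i j + a j i = (if i = j then 0 else 1)"
    and loop: "\<And>i. a i i = 0"
  defines "d \<equiv> \<lambda>i. \<Sum>j<n. a i j"
  shows "2 * (\<Sum>i<n. \<Sum>j<n. \<Sum>k<n. a i j * a j k * a k i) =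
    (2 * of_nat n - 1) * (\<Sum>i<n. d i) - 3 * (\<Sum>i<n. (d i)\<^sup>2)"
proof -
  define c where "c = (\<Sum>i<n. \<Sum>j<n. \<Sum>k<n. a i j * a j k * a k i)"
  define t where "t = (\<Sum>i<n. \<Sum>j<n. \<Sum>k<n. a i j * a i k * a j k)"
  \<comment> \<open>The column sums are the in-degrees.\<close>
  have in_deg: "(\<Sum>i<n. a i j) = of_nat n - 1 - d j" if "j < n" for j
  proof -
    have "(\<Sum>i<n. a i j + a j i) = (\<Sum>i<n. 1 - (if i = j then 1 else 0))"
      using that tour by (intro sum.cong) auto
    then show ?thesis
      using that by (simp add: sum.distrib sum_subtractf d_def algebra_simps)
  qed
  \<comment> \<open>A 2-path from \<open>i\<close> over \<open>j\<close> to \<open>k\<close> is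
    closed by the arc between \<open>i\<close> and \<open>k\<close> to either a cyclic or a
    transitive triple.\<close>
  have "c + t = (\<Sum>i<n. \<Sum>j<n. \<Sum>k<n. a i j * a j k)"
    unfolding c_def t_def sum.distrib[symmetric]
  proof (intro sum.cong refl)
    fix i j k assume "i \<in> {..<n}" "j \<in> {..<n}" "k \<in> {..<n}"
    then have *: "a k i + a i k = (if k = i then 0 else 1)"
      and ij: "a i j + a j i = (if i = j then 0 else 1)" using tour by auto
    \<comment> \<open>This covers \<open>k = i\<close>, where \<open>a k i + a i k\<close> is 0 and
      not 1.\<close>
    have "a i j * a j i = 0"
    proof (cases "i = j")
      case False
      then have "a j i = 1 - a i j" using ij by (simp add: eq_diff_eq add.commute)
      then show ?thesis by (simp add: right_diff_distrib idem)
    qed (simp add: loop)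
    then have "a i j * a j k * (a k i + a i k) = a i j * a j k"
      unfolding * by auto
    then show "a i j * a j k * a k i + a i j * a i k * a j k = a i j * a j k"
      by (simp add: algebra_simps)
  qed
  also have "\<dots> = (\<Sum>j<n. \<Sum>i<n. a i j * d j)"
    by (subst sum.swap) (simp add: d_def sum_distrib_left)
  also have "\<dots> = (\<Sum>j<n. (of_nat n - 1 - d j) * d j)"
    by (intro sum.cong) (auto simp: in_deg simp flip: sum_distrib_right)
  finally have 1: "c + t = (\<Sum>j<n. (of_nat n - 1 - d j) * d j)" .
  \<comment> \<open>Exchanging the names \<open>j\<close> and \<open>k\<close> reverses the last
    arc. Adding the two forms of \<open>t\<close> lets the arc between \<open>j\<close> and
    \<open>k\<close> drop out, except on the diagonal \<open>j = k\<close>, which has to be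
    subtracted.\<close>
  have t: "t = (\<Sum>i<n. \<Sum>j<n. \<Sum>k<n. a i j * a i k * a k j)"
    unfolding t_def by (rule sum.cong[OF refl], subst sum.swap) (simp add: ac_simps)
  have "2 * t = (\<Sum>i<n. \<Sum>j<n. \<Sum>k<n. a i j * a i k * (a j k + a k j))"
    by (simp only: distrib_left sum.distrib mult_2 t_def[symmetric] t[symmetric])
  also have "\<dots> = (\<Sum>i<n. \<Sum>j<n. \<Sum>k<n. a i j * a i k - (if k = j then a i j else 0))"
    using tour by (intro sum.cong) (auto simp: idem)
  also have "\<dots> = (\<Sum>i<n. (d i)\<^sup>2 - d i)"
    by (simp add: sum_subtractf d_def power2_eq_square sum_product)
  finally have 2: "2 * t = (\<Sum>i<n. (d i)\<^sup>2 - d i)" .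
  have "2 * c = 2 * (c + t) - 2 * t" by (simp add: algebra_simps)
  also have "\<dots> = (2 * of_nat n - 1) * (\<Sum>i<n. d i) - 3 * (\<Sum>i<n. (d i)\<^sup>2)"
    unfolding 1 2 unfolding sum_distrib_left sum_subtractf[symmetric]
    by (intro sum.cong) (auto simp: algebra_simps power2_eq_square)
  finally show ?thesis by (simp add: c_def)
qed

lemma pverts_tournament: "T \<in> tournaments n \<Longrightarrow> pverts T = {..<n}"
  by (simp add: tournaments_def)

lemma pair_digraph_tournament: "T \<in> tournaments n \<Longrightarrow> pair_digraph T"
  by (simp add: tournaments_def)

lemma of_nat_score:
  assumes "T \<in> tournaments n" "i < n"
  shows "of_nat (score T i) = (\<Sum>j<n. if (i, j) \<in> parcs T then 1 else 0 :: 'a :: semiring_1)"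
proof -
  interpret pair_digraph T by (rule pair_digraph_tournament) (rule assms)
  have "{e \<in> parcs T. fst e = i} = Pair i ` {j \<in> {..<n}. (i, j) \<in> parcs T}"
    using in_arcsD2 pverts_tournament[OF assms(1)] by auto
  then have "score T i = card {j \<in> {..<n}. (i, j) \<in> parcs T}"
    by (simp add: score_def out_degree_def out_arcs_def card_image inj_on_def)
  then show ?thesis
    by (simp flip: sum.inter_filter)
qed

lemma arc_irrefl_tournament:
  assumes "T \<in> tournaments n"
  shows "(i, i) \<notin> parcs T"
proof -
  interpret pair_digraph T by (rule pair_digraph_tournament) (rule assms)
  show ?thesis using no_loops'[of i i] by blast
qed

lemma arc_iff_tournament:
  assumes "T \<in> tournaments n" "i < n" "j < n" "i \<noteq> j"
  shows "(j, i) \<in> parcs T \<longleftrightarrow> (i, j) \<notin> parcs T"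
proof -
  have "i \<in> pverts T" "j \<in> pverts T" using assms by (simp_all add: pverts_tournament)
  from assms(1)[unfolded tournaments_def mem_Collect_eq, THEN conjunct2, THEN conjunct2,
      THEN bspec, OF this(1), THEN bspec, OF this(2), THEN mp, OF assms(4)]
  show ?thesis by argo
qed

lemma arc_asym_tournament:
  assumes "T \<in> tournaments n" "i < n" "j < n"
  shows "\<not> ((i, j) \<in> parcs T \<and> (j, i) \<in> parcs T)"
  using arc_iff_tournament[OF assms] arc_irrefl_tournament[OF assms(1), of i]
  by (cases "i = j") simp_all

text \<open>Without loops the scores form the diagonal of the Laplacian, whose trace is known. That
  the sum is the same for all tournaments of one order is what the comparison by chords relies
  on.\<close>

lemma sum_score_tournament:
  assumes T: "T \<in> tournaments n"
  shows "(\<Sum>i<n. score T i) = n choose 2"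
proof -
  have "of_nat (\<Sum>i<n. score T i) = mat_trace (laplacian T)"
    using T by (simp add: mat_trace_laplacian pverts_tournament laplacian_index
        arc_irrefl_tournament)
  then show ?thesis
    unfolding mat_trace_laplacian_tournament[OF T] of_nat_eq_iff .
qed

text \<open>For \<open>n < 2\<close> the denominator is 0, and both sides are 0 because division by
  zero yields 0.\<close>

lemma normalized_laplacian_index:
  assumes "T \<in> tournaments n" "i < n" "j < n"
  shows "normalized_laplacian T $$ (i, j) =
    ((if i = j then of_nat (score T i) else 0) - (if (i, j) \<in> parcs T then 1 else 0))
      / of_nat (n choose 2)"
  using assms laplacian_carrier[of T]
  by (simp add: normalized_laplacian_def mat_trace_laplacian_tournament pverts_tournament
      laplacian_index)

lemma of_real_power_sum_eq_trace:
  "of_real (power_sum k T) = mat_trace (normalized_laplacian T ^\<^sub>m k)"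
  unfolding of_real_power_sum eigenvalues_mset_def
  by (rule sum_proots_char_poly_power[OF normalized_laplacian_carrier])

text \<open>Off the diagonal, the product of the entries at \<open>(i, j)\<close> and
  \<open>(j, i)\<close> vanishes, since at most one of the two arcs is present. Only the squared
  scores remain in the trace.\<close>

lemma power_sum_2_tournament:
  assumes T: "T \<in> tournaments n"
  shows "power_sum 2 T = (\<Sum>i<n. (real (score T i))\<^sup>2) / (real (n choose 2))\<^sup>2"
proof -
  define N :: complex where "N = of_nat (n choose 2)"
  have M: "normalized_laplacian T \<in> carrier_mat n n"
    using normalized_laplacian_carrier[of T] T by (simp add: pverts_tournament)
  have "complex_of_real (power_sum 2 T) =
      (\<Sum>i<n. \<Sum>j<n. (if i = j then (of_nat (score T i))\<^sup>2 / N\<^sup>2 else 0))"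
    unfolding of_real_power_sum_eq_trace mat_trace_pow2[OF M]
  proof (intro sum.cong refl)
    fix i j assume "i \<in> {..<n}" "j \<in> {..<n}"
    then have ij: "i < n" "j < n" by auto
    show "normalized_laplacian T $$ (i, j) * normalized_laplacian T $$ (j, i)
      = (if i = j then (of_nat (score T i))\<^sup>2 / N\<^sup>2 else 0)"
      using ij arc_asym_tournament[OF T ij]
      by (auto simp: normalized_laplacian_index[OF T] N_def power2_eq_square
          arc_irrefl_tournament[OF T])
  qed
  also have "\<dots> = of_real ((\<Sum>i<n. (real (score T i))\<^sup>2) / (real (n choose 2))\<^sup>2)"
    by (simp add: N_def sum_divide_distrib)
  finally show ?thesis unfolding of_real_eq_iff .
qed

text \<open>In the expansion of tr (D - A)^3 each mixed term contains a loop or a pair of opposite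
  arcs, so tr D^3 - tr A^3 remains. The second trace is a sum over cyclic triples and is expressed
  by the scores.\<close>

lemma power_sum_3_tournament:
  assumes T: "T \<in> tournaments n"
  shows "power_sum 3 T =
    ((\<Sum>i<n. 2 * real (score T i) ^ 3 + 3 * (real (score T i))\<^sup>2)
      - (2 * real n - 1) * real (n choose 2)) / (2 * real (n choose 2) ^ 3)"
proof -
  define N :: complex where "N = of_nat (n choose 2)"
  define a :: "nat \<Rightarrow> nat \<Rightarrow> complex" where "a i j = (if (i, j) \<in> parcs T then 1 else 0)" for i j
  define d :: "nat \<Rightarrow> complex" where "d i = of_nat (score T i)" for i
  have d: "(\<Sum>j<n. a i j) = d i" if "i < n" for i
    unfolding a_def d_def of_nat_score[OF T that] ..
  have idem: "a i j * a i j = a i j" for i j by (simp add: a_def)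
  have loop: "a i i = 0" for i by (simp add: a_def arc_irrefl_tournament[OF T])
  have tour: "a i j + a j i = (if i = j then 0 else 1)" if "i < n" "j < n" for i j
    using arc_iff_tournament[OF T that]
    by (cases "i = j") (auto simp: a_def arc_irrefl_tournament[OF T])
  have sum_d: "(\<Sum>i<n. d i) = N"
    unfolding d_def N_def of_nat_sum[symmetric] sum_score_tournament[OF T] ..
  have M: "normalized_laplacian T \<in> carrier_mat n n"
    using normalized_laplacian_carrier[of T] T by (simp add: pverts_tournament)
  \<comment> \<open>The condition \<open>i = j = k\<close> is written as two nested tests so that
    the sums over \<open>k\<close> and then over \<open>j\<close> collapse one after the
    other.\<close>
  have "complex_of_real (power_sum 3 T) =
      (\<Sum>i<n. \<Sum>j<n. \<Sum>k<n.
        ((if k = j then if j = i then d i ^ 3 else 0 else 0) - a i j * a j k * a k i) / N ^ 3)"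
    unfolding of_real_power_sum_eq_trace mat_trace_pow3[OF M]
  proof (intro sum.cong refl)
    fix i j k assume "i \<in> {..<n}" "j \<in> {..<n}" "k \<in> {..<n}"
    then have ijk: "i < n" "j < n" "k < n" by auto
    have 2: "a x y * a y x = 0" if "x < n" "y < n" for x y
      using arc_asym_tournament[OF T that] by (auto simp: a_def)
    have entry: "normalized_laplacian T $$ (x, y) = ((if x = y then d x else 0) - a x y) / N"
      if "x < n" "y < n" for x y
      using that by (simp add: normalized_laplacian_index[OF T] a_def d_def N_def)
    \<comment> \<open>If exactly two of the indices agree, both sides vanish: a diagonal factor
      leaves a product of two opposite arcs on the left, and a loop appears on the right.\<close>
    have key: "((if i = j then d i else 0) - a i j) * ((if j = k then d j else 0) - a j k)
        * ((if k = i then d k else 0) - a k i)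
      = (if k = j then if j = i then d i ^ 3 else 0 else 0) - a i j * a j k * a k i"
      using 2[OF ijk(1,2)] 2[OF ijk(2,3)] 2[OF ijk(3,1)]
      by (auto simp: loop power3_eq_cube)
    show "normalized_laplacian T $$ (i, j) * normalized_laplacian T $$ (j, k)
        * normalized_laplacian T $$ (k, i)
      = ((if k = j then if j = i then d i ^ 3 else 0 else 0) - a i j * a j k * a k i) / N ^ 3"
      by (simp only: entry[OF ijk(1,2)] entry[OF ijk(2,3)] entry[OF ijk(3,1)] times_divide_times_eq
          power3_eq_cube[of N] key)
  qed
  also have "\<dots> = ((\<Sum>i<n. d i ^ 3)
      - (\<Sum>i<n. \<Sum>j<n. \<Sum>k<n. a i j * a j k * a k i)) / N ^ 3"
    unfolding sum_divide_distrib[symmetric] sum_subtractf by simp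
  \<comment> \<open>The fraction is expanded by 2 because \<open>sum_cyclic_triples\<close>
    evaluates twice the sum over triples.\<close>
  also have "\<dots> = (2 * (\<Sum>i<n. d i ^ 3)
      - 2 * (\<Sum>i<n. \<Sum>j<n. \<Sum>k<n. a i j * a j k * a k i)) / (2 * N ^ 3)"
    unfolding right_diff_distrib[symmetric] by (rule mult_divide_mult_cancel_left[symmetric]) simp
  also have "2 * (\<Sum>i<n. \<Sum>j<n. \<Sum>k<n. a i j * a j k * a k i) =
      (2 * of_nat n - 1) * N - 3 * (\<Sum>i<n. (d i)\<^sup>2)"
    using sum_cyclic_triples[OF idem tour loop] by (simp add: d sum_d)
  also have "(2 * (\<Sum>i<n. d i ^ 3) - \<dots>) / (2 * N ^ 3) = of_real
    (((\<Sum>i<n. 2 * real (score T i) ^ 3 + 3 * (real (score T i))\<^sup>2)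
      - (2 * real n - 1) * real (n choose 2)) / (2 * real (n choose 2) ^ 3))"
    by (simp add: N_def d_def sum.distrib sum_distrib_left)
  finally show ?thesis unfolding of_real_eq_iff .
qed

section \<open>Minimality\<close>

text \<open>The total of an affine function depends only on the sum of its arguments. The line thus
  has the same total at \<open>d\<close> and at \<open>e\<close>; it meets \<open>g\<close> at the
  values of \<open>d\<close> and nowhere exceeds \<open>g\<close>.\<close>

lemma sum_le_sum_of_chord:
  fixes g :: "nat \<Rightarrow> real" and d e :: "'i \<Rightarrow> nat"
  assumes ge: "\<And>k. g k \<ge> \<alpha> + \<beta> * real k"
    and eq: "\<And>i. i \<in> I \<Longrightarrow> g (d i) = \<alpha> + \<beta> * real (d i)"
    and sums: "(\<Sum>i\<in>I. d i) = (\<Sum>i\<in>I. e i)"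
  shows "(\<Sum>i\<in>I. g (d i)) \<le> (\<Sum>i\<in>I. g (e i))"
proof -
  have "(\<Sum>i\<in>I. g (d i)) = (\<Sum>i\<in>I. \<alpha>) + \<beta> * real (\<Sum>i\<in>I. d i)"
    by (simp add: eq sum.distrib sum_distrib_left)
  also have "\<dots> = (\<Sum>i\<in>I. \<alpha> + \<beta> * real (e i))"
    by (simp add: sums sum.distrib sum_distrib_left)
  also have "\<dots> \<le> (\<Sum>i\<in>I. g (e i))" by (intro sum_mono ge)
  finally show ?thesis .
qed

text \<open>Integrality enters here: no integer lies strictly between \<open>a\<close> and
  \<open>a + 1\<close>.\<close>

lemma mult_diff_consecutive_nonneg: "(real k - real a) * (real k - real a - 1) \<ge> 0"
proof (cases "k \<le> a")
  case True
  then show ?thesis by (intro mult_nonpos_nonpos) auto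
qed auto

lemma sum_square_le:
  fixes d e :: "'i \<Rightarrow> nat"
  assumes d: "\<And>i. i \<in> I \<Longrightarrow> d i \<in> {a, a + 1}" and sums: "(\<Sum>i\<in>I. d i) = (\<Sum>i\<in>I. e i)"
  shows "(\<Sum>i\<in>I. (real (d i))\<^sup>2) \<le> (\<Sum>i\<in>I. (real (e i))\<^sup>2)"
\<comment> \<open>The line is the chord of the square function through \<open>a\<close> and
  \<open>a + 1\<close>; the square minus the chord is \<open>(k - a) * (k - a - 1)\<close>.\<close>
proof (rule sum_le_sum_of_chord[where g = "\<lambda>k. (real k)\<^sup>2" and
      \<alpha> = "- (real a * (real a + 1))" and \<beta> = "2 * real a + 1", OF _ _ sums])
  show "(real k)\<^sup>2 \<ge> - (real a * (real a + 1)) + (2 * real a + 1) * real k" for k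
    using mult_diff_consecutive_nonneg[of k a] by (simp add: algebra_simps power2_eq_square)
  show "(real (d i))\<^sup>2 = - (real a * (real a + 1)) + (2 * real a + 1) * real (d i)"
    if "i \<in> I" for i
    using d[OF that] by (auto simp: algebra_simps power2_eq_square)
qed

lemma sum_cube_le:
  fixes d e :: "'i \<Rightarrow> nat"
  assumes d: "\<And>i. i \<in> I \<Longrightarrow> d i \<in> {a, a + 1}" and sums: "(\<Sum>i\<in>I. d i) = (\<Sum>i\<in>I. e i)"
  shows "(\<Sum>i\<in>I. real (d i) ^ 3) \<le> (\<Sum>i\<in>I. real (e i) ^ 3)"
proof -
  \<comment> \<open>Again the chord through \<open>a\<close> and \<open>a + 1\<close>. The cube
    minus the chord has no quadratic term, so its roots sum to 0 and the third one is
    \<open>- (2 * a + 1)\<close>, which gives a positive factor.\<close>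
  define \<alpha> \<beta> where "\<alpha> = - (real a * (real a + 1) * (2 * real a + 1))"
    and "\<beta> = 3 * (real a)\<^sup>2 + 3 * real a + 1"
  have factor: "real k ^ 3 - (\<alpha> + \<beta> * real k) =
      (real k - real a) * (real k - real a - 1) * (real k + 2 * real a + 1)" for k
    by (simp add: \<alpha>_def \<beta>_def algebra_simps power2_eq_square power3_eq_cube)
  show ?thesis
  proof (rule sum_le_sum_of_chord[where g = "\<lambda>k. real k ^ 3" and \<alpha> = \<alpha> and \<beta> = \<beta>, OF _ _ sums])
    show "real k ^ 3 \<ge> \<alpha> + \<beta> * real k" for k
      using mult_nonneg_nonneg[OF mult_diff_consecutive_nonneg[of k a], of "real k + 2 * real a + 1"]
      by (simp flip: factor)
    show "real (d i) ^ 3 = \<alpha> + \<beta> * real (d i)" if "i \<in> I" for i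
      using factor[of "d i"] d[OF that] by auto
  qed
qed

lemma minimizes_power_sums_balanced:
  assumes T: "T \<in> tournaments n" and balanced: "\<And>i. i < n \<Longrightarrow> score T i \<in> {a, a + 1}"
  shows "minimizes (power_sum 2) n T \<and> minimizes (power_sum 3) n T"
proof -
  have "power_sum 2 T \<le> power_sum 2 S \<and> power_sum 3 T \<le> power_sum 3 S"
    if S: "S \<in> tournaments n" for S
  proof -
    have sums: "(\<Sum>i<n. score T i) = (\<Sum>i<n. score S i)"
      by (simp add: sum_score_tournament[OF S] sum_score_tournament[OF T])
    have *: "(\<Sum>i<n. (real (score T i))\<^sup>2) \<le> (\<Sum>i<n. (real (score S i))\<^sup>2)"
      "(\<Sum>i<n. real (score T i) ^ 3) \<le> (\<Sum>i<n. real (score S i) ^ 3)"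
      by (intro sum_square_le[where a = a] sum_cube_le[where a = a] sums balanced; simp)+
    show ?thesis
      unfolding power_sum_2_tournament[OF S] power_sum_2_tournament[OF T]
        power_sum_3_tournament[OF S] power_sum_3_tournament[OF T]
      \<comment> \<open>Squares and cubes of the scores enter with positive coefficients; all other
        terms and the denominators depend on \<open>n\<close> only.\<close>
      using * by (auto intro!: divide_right_mono simp: sum.distrib simp flip: sum_distrib_left)
  qed
  then show ?thesis
    using T by (auto simp: minimizes_def is_arg_min_linorder)
qed

text \<open>The two score classes are disjoint and have \<open>n div 2\<close> elements each, so
  together they exhaust the vertices.\<close>

lemma nearly_regular_score:
  assumes T: "nearly_regular_tournament n T" and n: "n \<ge> 2" and i: "i < n"
  shows "score T i \<in> {n div 2 - 1, n div 2 - 1 + 1}"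
proof -
  have V: "pverts T = {..<n}" and "even n"
    using T pverts_tournament[of T n] unfolding nearly_regular_tournament_def by blast+
  define A where "A = {v. v < n \<and> score T v = n div 2 - 1}"
  define B where "B = {v. v < n \<and> score T v = n div 2}"
  have cards: "card A = n div 2" "card B = n div 2"
    using T unfolding nearly_regular_tournament_def A_def B_def V lessThan_iff by blast+
  \<comment> \<open>Subtraction is truncated, so for \<open>n = 0\<close> the two values would
    coincide.\<close>
  have "n div 2 - 1 \<noteq> n div 2" using n by linarith
  then have "A \<inter> B = {}" unfolding A_def B_def by auto
  moreover have "finite A" "finite B" unfolding A_def B_def by simp_all
  ultimately have "card (A \<union> B) = n div 2 + n div 2"
    by (simp only: card_Un_disjoint cards)
  also have "\<dots> = card {..<n}" using \<open>even n\<close> by (simp flip: mult_2)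
  finally have "A \<union> B = {..<n}"
    by (intro card_subset_eq) (auto simp only: A_def B_def finite_lessThan)
  with i have "i \<in> A \<union> B" by simp
  moreover have "n div 2 - 1 + 1 = n div 2" using n by linarith
  ultimately show ?thesis unfolding A_def B_def by auto
qed

theorem theorem1:
  fixes n :: nat
  assumes "n \<ge> 2"
  shows "(odd n \<longrightarrow> (\<forall>T. regular_tournament n T \<longrightarrow>
            minimizes (power_sum 2) n T \<and> minimizes (power_sum 3) n T)) \<and>
         (even n \<longrightarrow> (\<forall>T. nearly_regular_tournament n T \<longrightarrow>
            minimizes (power_sum 2) n T \<and> minimizes (power_sum 3) n T))"
proof (intro conjI allI impI)
  fix T assume "regular_tournament n T"
  then have "T \<in> tournaments n" and "\<And>i. i < n \<Longrightarrow> score T i \<in> {(n - 1) div 2, (n - 1) div 2 + 1}"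
    using pverts_tournament[of T n] unfolding regular_tournament_def by auto
  with assms show "minimizes (power_sum 2) n T" "minimizes (power_sum 3) n T"
    using minimizes_power_sums_balanced[of T n "(n - 1) div 2"] by auto
next
  fix T assume T: "nearly_regular_tournament n T"
  then have "T \<in> tournaments n" by (simp add: nearly_regular_tournament_def)
  then show "minimizes (power_sum 2) n T" "minimizes (power_sum 3) n T"
    using minimizes_power_sums_balanced[of T n] nearly_regular_score[OF T assms] by blast+
qed

end
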